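(* Assume that the ordinary differential equation $\frac{d}{dt}u(t) = f(u(t))$ has the invariants $\eta$ and $\mu$, and that $\pi$ is the projection operator onto the manifold defined by the invariant $\mu$. Assume moreover that the baseline one-step method is of order $p\ge 2$ and that $$\eta'(u^n)\,\pi'(u^n)\,f'(u^n)\,f(u^n) \neq 0 .$$ Then the quadratic-preserving relaxation method (defined in the context) is well-defined for sufficiently small time step sizes $\Delta t$: there is a unique solution $\gamma = 1 + \mathcal{O}(\Delta t^{p-1})$ of the scalar equation $$\eta\Bigl(\pi\bigl(u^n + \gamma(\hat u^{n+1}-u^n)\bigr)\Bigr) = \eta(u^n),$$ and the quadratic-preserving relaxation method is at least of order $p$ when the error of $u^{n+1}$ is measured at the relaxed time $t^{n+1} = t^n + \gamma\Delta t$. Moreover, the method conserves both invariants, i.e., $\eta(u^{n+1})=\eta(u^n)$ and $\mu(u^{n+1})=\mu(u^n)$.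
   Context: Invariants: a scalar function $\eta$ is an invariant (first integral) of the ODE $\frac{d}{dt}u = f(u)$ if $\eta'(u)f(u)=0$ for all $u$; likewise for $\mu$. Primes denote derivatives with respect to $u$; in particular $f'(u^n)f(u^n)$ is the Jacobian of $f$ applied to $f$, and $\pi'(u^n)$ is the Jacobian of $\pi$. The functions $f,\eta,\mu,\pi$ are assumed sufficiently smooth for the derivatives and order statements to make sense. Projection: $\pi$ is a (general, nonlinear) projection operator onto the manifold defined by the invariant $\mu$, i.e., onto the level set $\{u : \mu(u)=\mu(u^n)\}$ through the current numerical solution $u^n$: it takes values in this level set and leaves its points fixed. (Example: for $\mu$ the squared norm, $\pi(\tilde u)=\sqrt{\mu(u^n)/\mu(\tilde u)}\,\tilde u$.) Quadratic-preserving relaxation method: one step from $u^n\approx u(t^n)$ with step size $\Delta t$ is as follows. 1. Compute a provisional value $\tilde u^{n+1}\approx u(\tilde t^{n+1})$, $\tilde t^{n+1}=t^n+\Delta t$, using a given standard one-step method (the baseline method). 2. Project: $\hat u^{n+1}=\pi(\tilde u^{n+1})$. 3. Solve the scalar equation $\eta\bigl(\pi(u^n+\gamma(\hat u^{n+1}-u^n))\bigr)=\eta(u^n)$ for the scalar relaxation parameter $\gamma$. 4. Continue the integration with $u^{n+1}=\pi\bigl(u^n+\gamma(\hat u^{n+1}-u^n)\bigr)\approx u(t^{n+1})$, $t^{n+1}=t^n+\gamma\Delta t$, instead of $\tilde u^{n+1}$ and $\tilde t^{n+1}$. A one-step method is of order $p$ if its local error, i.e., the error after one step started from the exact value $u(t^n)=u^n$,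 is $\mathcal{O}(\Delta t^{p+1})$ as $\Delta t\to0$. Uniqueness of $\gamma$ refers to solutions of the form $\gamma=1+\mathcal{O}(\Delta t^{p-1})$ (note that $\gamma=0$ always solves the scalar equation trivially). *)

theory Defs
  imports "HOL-Analysis.Analysis" "HOL-Library.Landau_Symbols"
begin

text \<open>
  All maps are total functions, but hypotheses are only imposed on an open set \<open>D\<close> of states
  on which the right-hand side, the invariants and the projection are meaningful; for instance the
  radial projection onto a sphere lives on the complement of \<open>{0}\<close>.
\<close>

definition C1_on :: "'a::real_normed_vector set \<Rightarrow> ('a \<Rightarrow> 'b::real_normed_vector) \<Rightarrow> bool" where
  "C1_on D g \<longleftrightarrow> (\<exists>g' :: 'a \<Rightarrow> 'a \<Rightarrow>\<^sub>L 'b.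
     (\<forall>v\<in>D. (g has_derivative blinfun_apply (g' v)) (at v)) \<and> continuous_on D g')"

definition C2_on :: "'a::real_normed_vector set \<Rightarrow> ('a \<Rightarrow> 'b::real_normed_vector) \<Rightarrow> bool" where
  "C2_on D g \<longleftrightarrow> (\<exists>g' :: 'a \<Rightarrow> 'a \<Rightarrow>\<^sub>L 'b.
     (\<forall>v\<in>D. (g has_derivative blinfun_apply (g' v)) (at v)) \<and> C1_on D g')"

definition ode_solution_on ::
  "'a::real_normed_vector set \<Rightarrow> ('a \<Rightarrow> 'a) \<Rightarrow> (real \<Rightarrow> 'a) \<Rightarrow> real set \<Rightarrow> bool" where
  "ode_solution_on D f u I \<longleftrightarrow>
     (\<forall>t\<in>I. u t \<in> D \<and> (u has_vector_derivative f (u t)) (at t within I))"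

definition ode_invariant_on ::
  "'a::real_normed_vector set \<Rightarrow> ('a \<Rightarrow> 'a) \<Rightarrow> ('a \<Rightarrow> real) \<Rightarrow> bool" where
  "ode_invariant_on D f \<eta> \<longleftrightarrow>
     (\<forall>v\<in>D. \<eta> differentiable (at v) \<and> frechet_derivative \<eta> (at v) (f v) = 0)"

definition level_set_through :: "'a set \<Rightarrow> ('a \<Rightarrow> real) \<Rightarrow> 'a \<Rightarrow> 'a set" where
  "level_set_through D \<mu> w = {v \<in> D. \<mu> v = \<mu> w}"

definition projection_onto :: "'a set \<Rightarrow> 'a set \<Rightarrow> ('a \<Rightarrow> 'a) \<Rightarrow> bool" where
  "projection_onto D M \<pi> \<longleftrightarrow> \<pi> ` D \<subseteq> M \<and> (\<forall>v\<in>M. \<pi> v = v)"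

text \<open>
  A one-step method is a map \<open>\<Phi>\<close> taking the step size \<open>h\<close> and the current value to the new
  value. A local error of order \<open>p\<close> is measured against the exact solution \<open>u\<close>, where \<open>y h\<close> is
  the numerical value after one step of size \<open>h\<close> and \<open>\<tau> h\<close> is the time it approximates; for a
  relaxation method \<open>\<tau> h\<close> differs from the nominal end of the step.
\<close>

definition local_error_order ::
  "(real \<Rightarrow> 'a::real_normed_vector) \<Rightarrow> (real \<Rightarrow> real) \<Rightarrow> (real \<Rightarrow> 'a) \<Rightarrow> nat \<Rightarrow> bool" where
  "local_error_order u \<tau> y p \<longleftrightarrow>
     (\<lambda>h. norm (y h - u (\<tau> h))) \<in> O[at_right 0](\<lambda>h. h ^ (p + 1))"

definition relaxed_preimage ::
  "('a \<Rightarrow> 'a) \<Rightarrow> (real \<Rightarrow> 'a \<Rightarrow> 'a) \<Rightarrow> 'a::real_vector \<Rightarrow> real \<Rightarrow> real \<Rightarrow> 'a" where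
  "relaxed_preimage \<pi> \<Phi> un h \<gamma> = un + \<gamma> *\<^sub>R (\<pi> (\<Phi> h un) - un)"

definition relaxed_step ::
  "('a \<Rightarrow> 'a) \<Rightarrow> (real \<Rightarrow> 'a \<Rightarrow> 'a) \<Rightarrow> 'a::real_vector \<Rightarrow> real \<Rightarrow> real \<Rightarrow> 'a" where
  "relaxed_step \<pi> \<Phi> un h \<gamma> = \<pi> (relaxed_preimage \<pi> \<Phi> un h \<gamma>)"

text \<open>
  The two membership conditions say that \<open>\<pi>\<close> is only applied inside \<open>D\<close>, so that the step is
  genuinely defined and the scalar equation is not met by a junk value.
\<close>

definition solves_relaxation_equation ::
  "'a::real_vector set \<Rightarrow> ('a \<Rightarrow> real) \<Rightarrow> ('a \<Rightarrow> 'a) \<Rightarrow> (real \<Rightarrow> 'a \<Rightarrow> 'a) \<Rightarrow> 'a \<Rightarrow> real \<Rightarrow> real \<Rightarrow> bool"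
  where
  "solves_relaxation_equation D \<eta> \<pi> \<Phi> un h \<gamma> \<longleftrightarrow>
     \<Phi> h un \<in> D \<and> relaxed_preimage \<pi> \<Phi> un h \<gamma> \<in> D \<and> \<eta> (relaxed_step \<pi> \<Phi> un h \<gamma>) = \<eta> un"

text \<open>
  The relaxation parameter is a function of the step size, and \<open>\<gamma> = 1 + O(h ^ (p - 1))\<close> is an
  asymptotic condition on this function. The trivial solution \<open>\<gamma> = 0\<close> is thereby excluded.
\<close>

definition relaxation_parameter ::
  "'a::real_vector set \<Rightarrow> ('a \<Rightarrow> real) \<Rightarrow> ('a \<Rightarrow> 'a) \<Rightarrow> (real \<Rightarrow> 'a \<Rightarrow> 'a) \<Rightarrow> 'a \<Rightarrow> nat \<Rightarrow> (real \<Rightarrow> real) \<Rightarrow> bool"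
  where
  "relaxation_parameter D \<eta> \<pi> \<Phi> un p \<gamma> \<longleftrightarrow>
     (\<forall>\<^sub>F h in at_right 0. solves_relaxation_equation D \<eta> \<pi> \<Phi> un h (\<gamma> h)) \<and>
     (\<lambda>h. \<gamma> h - 1) \<in> O[at_right 0](\<lambda>h. h ^ (p - 1))"

end

theory Submission
  imports Defs
begin

text \<open>
  Write \<open>G = \<eta> \<circ> \<pi>\<close>, \<open>v = f un\<close>, \<open>w = f' un (f un)\<close> and let \<open>d h = \<pi> (\<Phi> h un) - un\<close> be the projected
  increment. The relaxation equation asks for a point of the chord \<open>un + \<gamma> d\<close> at which \<open>G\<close> has
  its initial value.

  The solution \<open>u\<close> stays in the level set of \<open>\<mu>\<close>, which \<open>\<pi>\<close> fixes, so \<open>G (u t) = \<eta> (u t)\<close> is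
  constant. Differentiating twice gives \<open>G' v = 0\<close> and \<open>G'' v v = - G' w\<close>
  (\<open>constant_along_curve_derivatives\<close>). Together with \<open>d = h v + h\<^sup>2 / 2 w + o(h\<^sup>2)\<close>, which follows from
  \<open>right_Taylor_2\<close> and the order of the baseline method, the derivative of \<open>G\<close> along the chord is
  \<open>h\<^sup>2 (1/2 - \<gamma>) G' w + o(h\<^sup>2)\<close> (\<open>derivative_along_chord_asymptotics\<close>). Here \<open>G' w\<close> is precisely the
  quantity assumed to be nonzero, because \<open>\<pi> un = un\<close>. Near \<open>\<gamma> = 1\<close> the slope is thus of exact size
  \<open>h\<^sup>2\<close>, whereas at \<open>\<gamma> = 1\<close> the defect of \<open>G\<close> is \<open>O(h ^ (p + 1))\<close>. An intermediate value argument yields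
  a unique zero near \<open>1\<close>, at distance \<open>O(h ^ (p - 1))\<close> (\<open>unique_level_point_on_chord\<close>).

  For the order, replacing \<open>1\<close> by \<open>\<gamma>\<close> moves the chord point and the solution by
  the same amount up to \<open>(\<gamma> - 1) O(h\<^sup>2) = O(h ^ (p + 1))\<close> (\<open>chord_follows_curve\<close>), and the final projection
  is locally Lipschitz and fixes the solution (\<open>bigo_Lipschitz_image\<close>). Conservation of \<open>\<eta>\<close> is the
  relaxation equation itself, and conservation of \<open>\<mu>\<close> holds because \<open>\<pi>\<close> has values in its level set.
\<close>

section \<open>Local Lipschitz bounds and error orders\<close>

text \<open>
  Near \<open>x\<close> the derivative is bounded by \<open>norm (g' x) + 1\<close>, so the mean value inequality applies on
  a small ball. Continuity of \<open>g'\<close> at the single point \<open>x\<close> is enough for this.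
\<close>

lemma locally_Lipschitz_at:
  fixes g :: "'a::real_normed_vector \<Rightarrow> 'b::real_normed_vector" and g' :: "'a \<Rightarrow> 'a \<Rightarrow>\<^sub>L 'b"
  assumes "open D" "x \<in> D"
    and deriv: "\<And>v. v \<in> D \<Longrightarrow> (g has_derivative blinfun_apply (g' v)) (at v)"
    and cont: "isCont g' x"
  obtains L r where "0 \<le> L" "0 < r" "ball x r \<subseteq> D"
    "\<And>y z. y \<in> ball x r \<Longrightarrow> z \<in> ball x r \<Longrightarrow> norm (g y - g z) \<le> L * norm (y - z)"
proof -
  obtain r1 where r1: "0 < r1" "ball x r1 \<subseteq> D"
    using assms(1,2) open_contains_ball by blast
  obtain r2 where r2: "0 < r2" "\<And>v. dist v x < r2 \<Longrightarrow> dist (g' v) (g' x) < 1"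
    using cont[unfolded continuous_at_eps_delta, rule_format, OF zero_less_one] by blast
  define r where "r = min r1 r2"
  have Lip: "norm (g y - g z) \<le> (norm (g' x) + 1) * norm (y - z)"
    if yz: "y \<in> ball x r" "z \<in> ball x r" for y z
  proof (rule differentiable_bound[OF convex_ball _ _ yz])
    fix v assume v: "v \<in> ball x r"
    show "(g has_derivative blinfun_apply (g' v)) (at v within ball x r)"
      using v r1 by (auto simp: r_def intro!: has_derivative_at_withinI[OF deriv])
    have "norm (g' v - g' x) < 1"
      using r2(2)[of v] v by (simp add: r_def dist_commute flip: dist_norm)
    then show "onorm (blinfun_apply (g' v)) \<le> norm (g' x) + 1"
      using norm_triangle_ineq2[of "g' v" "g' x"] by (simp add: norm_blinfun.rep_eq)
  qed
  show ?thesis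
  proof (rule that[OF _ _ _ Lip])
    show "ball x r \<subseteq> D" using r1(2) by (auto simp: r_def)
  qed (use r1(1) r2(1) in \<open>simp_all add: r_def\<close>)
qed

text \<open>
  Smooth maps propagate error orders: this is how the order of the baseline method is handed on
  through the projection and to the invariant.
\<close>

lemma bigo_Lipschitz_image:
  fixes g :: "'a::real_normed_vector \<Rightarrow> 'b::real_normed_vector" and g' :: "'a \<Rightarrow> 'a \<Rightarrow>\<^sub>L 'b"
    and q :: "'c \<Rightarrow> real"
  assumes "open D" "x \<in> D"
    and "\<And>v. v \<in> D \<Longrightarrow> (g has_derivative blinfun_apply (g' v)) (at v)" "isCont g' x"
    and y: "(y \<longlongrightarrow> x) F" and z: "(z \<longlongrightarrow> x) F"
    and yz: "(\<lambda>h. norm (y h - z h)) \<in> O[F](q)"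
  shows "(\<lambda>h. norm (g (y h) - g (z h))) \<in> O[F](q)"
proof -
  obtain L r where L: "0 \<le> L" "0 < r"
      "\<And>y z. y \<in> ball x r \<Longrightarrow> z \<in> ball x r \<Longrightarrow> norm (g y - g z) \<le> L * norm (y - z)"
    using locally_Lipschitz_at[OF assms(1-4)] by metis
  have "\<forall>\<^sub>F h in F. norm (norm (g (y h) - g (z h))) \<le> L * norm (norm (y h - z h))"
    using tendstoD[OF y L(2)] tendstoD[OF z L(2)]
    by eventually_elim (simp add: L(3) dist_commute)
  then have "(\<lambda>h. norm (g (y h) - g (z h))) \<in> O[F](\<lambda>h. norm (y h - z h))"
    by (rule bigoI)
  then show ?thesis using yz by (rule landau_o.big_trans)
qed

lemma bigo_power_quotient_tendsto_0:
  fixes y :: "real \<Rightarrow> 'a::real_normed_vector"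
  assumes "(\<lambda>h. norm (y h)) \<in> O[at_right 0](\<lambda>h. h ^ (n + k))" "n > 0"
  shows "((\<lambda>h. y h /\<^sub>R h ^ k) \<longlongrightarrow> 0) (at_right 0)"
proof -
  obtain C where C: "C > 0" "\<forall>\<^sub>F h in at_right 0. norm (norm (y h)) \<le> C * norm (h ^ (n + k))"
    using assms(1) by (rule landau_o.bigE)
  show ?thesis
  proof (rule Lim_null_comparison)
    show "\<forall>\<^sub>F h in at_right 0. norm (y h /\<^sub>R h ^ k) \<le> C * h ^ n"
      using C(2) eventually_at_right_less[of "0::real"]
    proof eventually_elim
      case (elim h)
      then have pos: "h ^ k > 0" "h > 0" by simp_all
      have "norm (y h) \<le> C * h ^ (n + k)" using elim(1) pos(2) by simp
      then have "norm (y h) \<le> (C * h ^ n) * h ^ k" by (simp only: power_add mult.assoc)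
      then have "norm (y h) / h ^ k \<le> C * h ^ n" using pos(1) by (simp only: pos_divide_le_eq)
      moreover have "norm (y h /\<^sub>R h ^ k) = norm (y h) / h ^ k"
        using pos by (simp add: norm_inverse norm_power divide_inverse)
      ultimately show ?case by simp
    qed
    have "((\<lambda>h::real. C * h ^ n) \<longlongrightarrow> C * 0 ^ n) (at_right 0)" by (intro tendsto_intros)
    then show "((\<lambda>h::real. C * h ^ n) \<longlongrightarrow> 0) (at_right 0)" by (simp only: zero_power[OF \<open>n > 0\<close>] mult_zero_right)
  qed
qed

section \<open>Solutions and invariants at the initial time\<close>

text \<open>
  The invariance condition says exactly that the chain rule gives derivative zero along a solution.
\<close>

lemma invariant_constant_along_solution:
  assumes inv: "ode_invariant_on D f \<eta>" and sol: "ode_solution_on D f u {a..b}"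
    and t: "t \<in> {a..b}"
  shows "\<eta> (u t) = \<eta> (u a)"
proof (rule has_derivative_zero_unique[of "{a..b}" "\<lambda>t. \<eta> (u t)"])
  fix s assume s: "s \<in> {a..b}"
  have us: "u s \<in> D" "(u has_vector_derivative f (u s)) (at s within {a..b})"
    using sol s by (auto simp: ode_solution_on_def)
  have eta: "(\<eta> has_derivative frechet_derivative \<eta> (at (u s))) (at (u s))"
    "frechet_derivative \<eta> (at (u s)) (f (u s)) = 0"
    using inv us(1) by (auto simp: ode_invariant_on_def frechet_derivative_works)
  have lin: "frechet_derivative \<eta> (at (u s)) (r *\<^sub>R f (u s)) = 0" for r
    using linear_cmul[OF has_derivative_linear[OF eta(1)]] eta(2) by simp
  show "((\<lambda>t. \<eta> (u t)) has_derivative (\<lambda>h. 0)) (at s within {a..b})"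
    using has_derivative_compose[OF us(2)[unfolded has_vector_derivative_def] eta(1)]
    by (simp add: lin)
qed (use t in auto)

text \<open>
  A derivative at the left end of an interval, rewritten as a limit for \<open>h \<longlongrightarrow> 0+\<close>, the filter in
  which step sizes are measured.
\<close>

lemma right_difference_quotient:
  fixes v :: "real \<Rightarrow> 'a::real_normed_vector"
  assumes "(v has_vector_derivative w) (at a within {a..a + T})" "T > 0"
  shows "((\<lambda>h. (v (a + h) - v a) /\<^sub>R h) \<longlongrightarrow> w) (at_right 0)"
proof -
  have lim: "((\<lambda>y. (v y - v a) /\<^sub>R (y - a) - w) \<longlongrightarrow> 0) (at_right a)"
  proof (rule Lim_transform_eventually)
    show "((\<lambda>y. (1 / norm (y - a)) *\<^sub>R (v y - (v a + (y - a) *\<^sub>R w))) \<longlongrightarrow> 0) (at_right a)"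
      using assms by (simp add: has_vector_derivative_def has_derivative_within at_within_Icc_at_right)
    show "\<forall>\<^sub>F y in at_right a. (1 / norm (y - a)) *\<^sub>R (v y - (v a + (y - a) *\<^sub>R w))
        = (v y - v a) /\<^sub>R (y - a) - w"
      unfolding eventually_at_filter
    proof (intro always_eventually allI impI)
      fix y assume "y \<noteq> a" "y \<in> {a<..}"
      then have "y - a > 0" by simp
      then show "(1 / norm (y - a)) *\<^sub>R (v y - (v a + (y - a) *\<^sub>R w)) = (v y - v a) /\<^sub>R (y - a) - w"
        by (simp add: scaleR_right_diff_distrib scaleR_add_right inverse_eq_divide diff_diff_add[symmetric])
    qed
  qed
  \<comment> \<open>Shift the base point of the filter from \<open>a\<close> to \<open>0\<close>.\<close>
  have "((\<lambda>h. (v (a + h) - v a) /\<^sub>R h - w) \<longlongrightarrow> 0) (at_right 0)"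
    using lim by (simp add: at_right_to_0[of a] filterlim_filtermap add.commute)
  then show ?thesis by (simp add: LIM_zero_iff)
qed

text \<open>
  Second-order Taylor expansion at the left end of an interval for a curve whose velocity is merely
  differentiable at that end. Subtracting the quadratic term \<open>(t - a)\<^sup>2 / 2 *\<^sub>R w\<close> leaves a curve with
  velocity \<open>v a + o(h)\<close> on \<open>{a..a + h}\<close>, and the mean value inequality turns this into an error \<open>o(h\<^sup>2)\<close>.
\<close>

lemma right_Taylor_2:
  fixes u v :: "real \<Rightarrow> 'a::real_normed_vector"
  assumes du: "\<And>t. t \<in> {a..a + T} \<Longrightarrow> (u has_vector_derivative v t) (at t within {a..a + T})"
    and dv: "(v has_vector_derivative w) (at a within {a..a + T})" and "T > 0"
  shows "((\<lambda>h. (u (a + h) - u a - h *\<^sub>R v a) /\<^sub>R h\<^sup>2) \<longlongrightarrow> w /\<^sub>R 2) (at_right 0)"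
proof (rule tendstoI)
  fix e :: real assume "e > 0"
  have "\<forall>\<^sub>F h in at_right 0. dist ((v (a + h) - v a) /\<^sub>R h) w < e / 2"
    using tendstoD[OF right_difference_quotient[OF dv \<open>T > 0\<close>], of "e / 2"] \<open>e > 0\<close> by simp
  then obtain b where b: "b > 0" "\<And>h. 0 < h \<Longrightarrow> h < b \<Longrightarrow> dist ((v (a + h) - v a) /\<^sub>R h) w < e / 2"
    unfolding eventually_at_right_field by auto
  have "dist ((u (a + h) - u a - h *\<^sub>R v a) /\<^sub>R h\<^sup>2) (w /\<^sub>R 2) < e" if h: "0 < h" "h < min b T" for h
  proof -
    define q where "q t = u t - ((t - a)\<^sup>2 / 2) *\<^sub>R w" for t
    have dq: "(q has_vector_derivative v t - (t - a) *\<^sub>R w) (at t within {a..a + h})"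
      if t: "t \<in> {a..a + h}" for t
    proof -
      have "(u has_vector_derivative v t) (at t within {a..a + h})"
        using t h by (intro has_vector_derivative_within_subset[OF du]) auto
      then show ?thesis
        unfolding q_def by (auto intro!: derivative_eq_intros)
    qed
    have bd: "norm ((v t - (t - a) *\<^sub>R w) - (v a - (a - a) *\<^sub>R w)) \<le> h * (e / 2)"
      if t: "t \<in> {a..a + h}" for t
    proof (cases "t = a")
      case False
      define k where "k = t - a"
      have k: "0 < k" "k < b" "k \<le> h" "t = a + k" using t h False by (auto simp: k_def)
      have "v t - v a - k *\<^sub>R w = k *\<^sub>R ((v (a + k) - v a) /\<^sub>R k - w)"
        using k by (simp add: scaleR_right_diff_distrib)
      then have "norm (v t - v a - k *\<^sub>R w) = k * dist ((v (a + k) - v a) /\<^sub>R k) w"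
        using k by (simp add: dist_norm)
      also have "\<dots> \<le> h * (e / 2)" using b(2)[of k] k by (intro mult_mono) auto
      finally show ?thesis by (simp add: k_def algebra_simps)
    qed (use h \<open>e > 0\<close> in auto)
    have "norm (q (a + h) - q a - (a + h - a) *\<^sub>R (v a - (a - a) *\<^sub>R w)) \<le> norm (a + h - a) * (h * (e / 2))"
      by (rule vector_differentiable_bound_linearization[where S = "{a..a + h}", OF dq _ bd])
         (use h in \<open>auto simp: closed_segment_eq_real_ivl\<close>)
    then have *: "norm (u (a + h) - u a - h *\<^sub>R v a - (h\<^sup>2 / 2) *\<^sub>R w) \<le> h\<^sup>2 * (e / 2)"
      using h by (simp add: q_def algebra_simps power2_eq_square)
    have "u (a + h) - u a - h *\<^sub>R v a - (h\<^sup>2 / 2) *\<^sub>R w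
        = h\<^sup>2 *\<^sub>R ((u (a + h) - u a - h *\<^sub>R v a) /\<^sub>R h\<^sup>2 - w /\<^sub>R 2)"
      using h by (simp add: scaleR_right_diff_distrib)
    with * have "h\<^sup>2 * dist ((u (a + h) - u a - h *\<^sub>R v a) /\<^sub>R h\<^sup>2) (w /\<^sub>R 2) \<le> h\<^sup>2 * (e / 2)"
      by (simp add: dist_norm)
    then have "dist ((u (a + h) - u a - h *\<^sub>R v a) /\<^sub>R h\<^sup>2) (w /\<^sub>R 2) \<le> e / 2"
      using h by (simp only: mult_le_cancel_left_pos zero_less_power)
    then show ?thesis using \<open>e > 0\<close> by simp
  qed
  then show "\<forall>\<^sub>F h in at_right 0. dist ((u (a + h) - u a - h *\<^sub>R v a) /\<^sub>R h\<^sup>2) (w /\<^sub>R 2) < e"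
    unfolding eventually_at_right_field using b(1) \<open>T > 0\<close> by (intro exI[of _ "min b T"]) auto
qed

text \<open>
  Differentiating \<open>G (u t) = const\<close> once gives \<open>G' (u t) (v t) = 0\<close> on the whole interval, and
  differentiating this identity once more at \<open>a\<close>, by the product rule, gives the second identity.
  It lets the unknown second derivative \<open>H v v\<close> be replaced by \<open>- G' w\<close>.
\<close>

lemma constant_along_curve_derivatives:
  fixes G :: "'a::real_normed_vector \<Rightarrow> real" and G' :: "'a \<Rightarrow> 'a \<Rightarrow>\<^sub>L real"
    and H :: "'a \<Rightarrow>\<^sub>L 'a \<Rightarrow>\<^sub>L real"
  assumes G: "\<And>y. y \<in> D \<Longrightarrow> (G has_derivative blinfun_apply (G' y)) (at y)"
    and H: "(G' has_derivative blinfun_apply H) (at (u a))"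
    and uD: "\<And>t. t \<in> {a..b} \<Longrightarrow> u t \<in> D"
    and du: "\<And>t. t \<in> {a..b} \<Longrightarrow> (u has_vector_derivative v t) (at t within {a..b})"
    and dv: "(v has_vector_derivative w) (at a within {a..b})"
    and const: "\<And>t. t \<in> {a..b} \<Longrightarrow> G (u t) = G (u a)" and "a < b"
  shows "G' (u a) (v a) = 0" and "G' (u a) w + H (v a) (v a) = 0"
proof -
  have first: "G' (u t) (v t) = 0" if t: "t \<in> {a..b}" for t
  proof -
    have "((\<lambda>s. G (u s)) has_vector_derivative G' (u t) (v t)) (at t within {a..b})"
      using has_derivative_compose[OF du[OF t, unfolded has_vector_derivative_def] G[OF uD[OF t]]]
      by (simp add: has_vector_derivative_def blinfun.scaleR_right)
    moreover have "((\<lambda>s. G (u s)) has_vector_derivative 0) (at t within {a..b})"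
      by (rule has_vector_derivative_transform[OF t const has_vector_derivative_const])
    ultimately show ?thesis
      by (rule vector_derivative_unique_within_closed_interval
          [of a b t, unfolded box_real, OF \<open>a < b\<close> t])
  qed
  have a: "a \<in> {a..b}" using \<open>a < b\<close> by simp
  show "G' (u a) (v a) = 0" by (rule first[OF a])
  have "((\<lambda>t. G' (u t)) has_vector_derivative H (v a)) (at a within {a..b})"
    using has_derivative_compose[OF du[OF a, unfolded has_vector_derivative_def] H]
    by (simp add: has_vector_derivative_def blinfun.scaleR_right)
  from bounded_bilinear.has_vector_derivative[OF bounded_bilinear_blinfun_apply this dv]
  have "((\<lambda>t. G' (u t) (v t)) has_vector_derivative G' (u a) w + H (v a) (v a)) (at a within {a..b})" .
  moreover have "((\<lambda>t. G' (u t) (v t)) has_vector_derivative 0) (at a within {a..b})"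
    by (rule has_vector_derivative_transform[OF a first has_vector_derivative_const])
  ultimately show "G' (u a) w + H (v a) (v a) = 0"
    by (rule vector_derivative_unique_within_closed_interval
        [of a b a, unfolded box_real, OF \<open>a < b\<close> a])
qed

section \<open>Level points on a chord\<close>

text \<open>
  A second-order expansion of the increment \<open>d\<close> contains the first-order one.
\<close>

lemma chord_quotient_tendsto:
  fixes d :: "real \<Rightarrow> 'a::real_normed_vector"
  assumes "((\<lambda>h. (d h - h *\<^sub>R v) /\<^sub>R h\<^sup>2) \<longlongrightarrow> w) (at_right 0)"
  shows "((\<lambda>h. d h /\<^sub>R h) \<longlongrightarrow> v) (at_right 0)" and "(d \<longlongrightarrow> 0) (at_right 0)"
proof -
  have "((\<lambda>h. h *\<^sub>R ((d h - h *\<^sub>R v) /\<^sub>R h\<^sup>2) + v) \<longlongrightarrow> 0 *\<^sub>R w + v) (at_right 0)"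
    by (intro tendsto_intros assms)
  moreover have "\<forall>\<^sub>F h in at_right 0. h *\<^sub>R ((d h - h *\<^sub>R v) /\<^sub>R h\<^sup>2) + v = d h /\<^sub>R h"
    using eventually_at_right_less[of "0::real"]
    by eventually_elim (simp add: power2_eq_square scaleR_right_diff_distrib mult.assoc[symmetric])
  ultimately show *: "((\<lambda>h. d h /\<^sub>R h) \<longlongrightarrow> v) (at_right 0)"
    by (auto intro: Lim_transform_eventually)
  have "((\<lambda>h. h *\<^sub>R (d h /\<^sub>R h)) \<longlongrightarrow> 0 *\<^sub>R v) (at_right 0)"
    by (intro tendsto_intros *)
  moreover have "\<forall>\<^sub>F h in at_right 0. h *\<^sub>R (d h /\<^sub>R h) = d h"
    using eventually_at_right_less[of "0::real"] by eventually_elim simp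
  ultimately show "(d \<longlongrightarrow> 0) (at_right 0)"
    by (auto intro: Lim_transform_eventually)
qed

text \<open>
  Expand \<open>G' (x + \<gamma> d) d = G' x d + \<gamma> H d d + o(\<bar>d\<bar>\<^sup>2)\<close>. The term of order \<open>h\<close> drops out since
  \<open>G' x v = 0\<close>. At order \<open>h\<^sup>2\<close> the two contributions are \<open>G' x w / 2\<close> and \<open>\<gamma> H v v = - \<gamma> G' x w\<close>,
  which combine to \<open>(1/2 - \<gamma>) G' x w\<close>. Hence \<open>G\<close> varies along the chord at the
  exact rate \<open>h\<^sup>2\<close> near \<open>\<gamma> = 1\<close> as soon as \<open>G' x w \<noteq> 0\<close>. The uniformity in \<open>\<gamma>\<close>
  is what permits integrating this rate.
\<close>

lemma derivative_along_chord_asymptotics: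
  fixes G' :: "'a::real_normed_vector \<Rightarrow> 'a \<Rightarrow>\<^sub>L real" and H :: "'a \<Rightarrow>\<^sub>L 'a \<Rightarrow>\<^sub>L real"
  assumes H: "(G' has_derivative blinfun_apply H) (at x)"
    and d: "((\<lambda>h. (d h - h *\<^sub>R v) /\<^sub>R h\<^sup>2) \<longlongrightarrow> w /\<^sub>R 2) (at_right 0)"
    and first: "G' x v = 0" and second: "G' x w + H v v = 0"
    and "e > 0"
  shows "\<forall>\<^sub>F h in at_right 0. \<forall>\<gamma>. \<bar>\<gamma>\<bar> \<le> 2 \<longrightarrow>
      \<bar>G' (x + \<gamma> *\<^sub>R d h) (d h) - h\<^sup>2 * ((1/2 - \<gamma>) * G' x w)\<bar> \<le> e * h\<^sup>2"
proof -
  \<comment> \<open>\<open>k h\<close> eventually bounds \<open>norm (d h)\<close>; the error budget \<open>e h\<^sup>2\<close> is split into one quarter for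
    \<open>G' x d\<close>, two for \<open>\<gamma> H d d\<close> (as \<open>\<bar>\<gamma>\<bar> \<le> 2\<close>) and one for the remainder of \<open>G'\<close>, which fixes \<open>e3\<close>.\<close>
  define k where "k = norm v + 1"
  have k: "k > 0" by (simp add: k_def add_nonneg_pos)
  define e3 where "e3 = e / 8 / k\<^sup>2"
  have e3: "e3 > 0" using k \<open>e > 0\<close> by (simp add: e3_def)
  note dh = chord_quotient_tendsto[OF d]
  have "((\<lambda>h. G' x ((d h - h *\<^sub>R v) /\<^sub>R h\<^sup>2)) \<longlongrightarrow> G' x (w /\<^sub>R 2)) (at_right 0)"
    by (intro tendsto_intros d)
  then have E1: "\<forall>\<^sub>F h in at_right 0. dist (G' x ((d h - h *\<^sub>R v) /\<^sub>R h\<^sup>2)) (G' x (w /\<^sub>R 2)) < e / 4"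
    by (rule tendstoD) (use \<open>e > 0\<close> in simp)
  have "((\<lambda>h. H (d h /\<^sub>R h) (d h /\<^sub>R h)) \<longlongrightarrow> H v v) (at_right 0)"
    by (intro tendsto_intros dh)
  then have E2: "\<forall>\<^sub>F h in at_right 0. dist (H (d h /\<^sub>R h) (d h /\<^sub>R h)) (H v v) < e / 4"
    by (rule tendstoD) (use \<open>e > 0\<close> in simp)
  have "((\<lambda>h. norm (d h /\<^sub>R h)) \<longlongrightarrow> norm v) (at_right 0)"
    by (intro tendsto_intros dh)
  then have E3: "\<forall>\<^sub>F h in at_right 0. norm (d h /\<^sub>R h) < k"
    by (rule order_tendstoD) (simp add: k_def)
  obtain r where r: "r > 0" "\<And>y. norm (y - x) < r \<Longrightarrow> norm (G' y - G' x - H (y - x)) \<le> e3 * norm (y - x)"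
    using H e3 unfolding has_derivative_at_alt by meson
  have E4: "\<forall>\<^sub>F h in at_right 0. norm (d h) < r / 2"
    using tendstoD[OF dh(2), of "r/2"] r(1) by simp
  from E1 E2 E3 E4 eventually_at_right_less[of "0::real"] show ?thesis
  proof eventually_elim
    case (elim h)
    have h: "h > 0" "h \<noteq> 0" using elim by auto
    have B1: "\<bar>G' x (d h) - h\<^sup>2 / 2 * G' x w\<bar> \<le> e / 4 * h\<^sup>2"
    proof -
      have "\<bar>G' x (d h) - h\<^sup>2 / 2 * G' x w\<bar>
          = h\<^sup>2 * dist (G' x ((d h - h *\<^sub>R v) /\<^sub>R h\<^sup>2)) (G' x (w /\<^sub>R 2))"
        using h by (simp add: dist_real_def blinfun.diff_right blinfun.scaleR_right first
            flip: abs_mult_pos' ) (simp add: field_simps abs_mult)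
      then show ?thesis using elim(1) h by (simp add: mult.commute)
    qed
    have B2: "\<bar>H (d h) (d h) - h\<^sup>2 * H v v\<bar> \<le> e / 4 * h\<^sup>2"
    proof -
      have "H (h *\<^sub>R y) (h *\<^sub>R y) = h\<^sup>2 * H y y" for y
        by (simp add: blinfun.scaleR_right blinfun.scaleR_left power2_eq_square)
      from this[of "d h /\<^sub>R h"] have "H (d h) (d h) = h\<^sup>2 * H (d h /\<^sub>R h) (d h /\<^sub>R h)"
        using h(2) by simp
      then have "\<bar>H (d h) (d h) - h\<^sup>2 * H v v\<bar> = h\<^sup>2 * dist (H (d h /\<^sub>R h) (d h /\<^sub>R h)) (H v v)"
        by (simp add: dist_real_def abs_mult flip: right_diff_distrib)
      then show ?thesis using elim(2) h by (simp add: mult.commute)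
    qed
    have B3: "norm (d h) \<le> k * h"
      using elim(3) h by (simp add: field_simps)
    show ?case
    proof (intro allI impI)
      fix \<gamma> :: real assume g: "\<bar>\<gamma>\<bar> \<le> 2"
      define R where "R = G' (x + \<gamma> *\<^sub>R d h) - G' x - H (\<gamma> *\<^sub>R d h)"
      have "\<bar>\<gamma>\<bar> * norm (d h) \<le> 2 * norm (d h)" using g by (intro mult_right_mono) auto
      then have gd: "norm (\<gamma> *\<^sub>R d h) \<le> 2 * norm (d h)" by simp
      then have "norm R \<le> e3 * norm (\<gamma> *\<^sub>R d h)"
        using r(2)[of "x + \<gamma> *\<^sub>R d h"] elim(4) by (simp add: R_def)
      also have "\<dots> \<le> e3 * (2 * norm (d h))" using gd e3 by (intro mult_left_mono) auto
      finally have "norm R * norm (d h) \<le> e3 * (2 * norm (d h)) * norm (d h)"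
        by (intro mult_right_mono) auto
      also have "\<dots> = 2 * e3 * (norm (d h))\<^sup>2" by (simp add: power2_eq_square)
      also have "\<dots> \<le> 2 * e3 * (k * h)\<^sup>2"
        using B3 e3 by (intro mult_left_mono power_mono) auto
      also have "\<dots> = e / 4 * h\<^sup>2" using k by (simp add: e3_def power_mult_distrib)
      finally have "norm R * norm (d h) \<le> e / 4 * h\<^sup>2" .
      moreover have "\<bar>R (d h)\<bar> \<le> norm R * norm (d h)"
        using norm_blinfun[of R "d h"] by simp
      ultimately have BR: "\<bar>R (d h)\<bar> \<le> e / 4 * h\<^sup>2" by linarith
      have G'_split: "G' (x + \<gamma> *\<^sub>R d h) (d h) = G' x (d h) + \<gamma> * H (d h) (d h) + R (d h)"
        by (simp add: R_def blinfun.diff_left blinfun.scaleR_right blinfun.scaleR_left)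
      have Hvv: "H v v = - G' x w" using second by simp
      have eq: "G' (x + \<gamma> *\<^sub>R d h) (d h) - h\<^sup>2 * ((1/2 - \<gamma>) * G' x w)
          = (G' x (d h) - h\<^sup>2 / 2 * G' x w) + \<gamma> * (H (d h) (d h) - h\<^sup>2 * H v v) + R (d h)"
        unfolding G'_split Hvv by (simp add: algebra_simps)
      have "\<bar>G' (x + \<gamma> *\<^sub>R d h) (d h) - h\<^sup>2 * ((1/2 - \<gamma>) * G' x w)\<bar>
          \<le> \<bar>G' x (d h) - h\<^sup>2 / 2 * G' x w\<bar> + \<bar>\<gamma> * (H (d h) (d h) - h\<^sup>2 * H v v)\<bar> + \<bar>R (d h)\<bar>"
        unfolding eq by (rule order_trans[OF abs_triangle_ineq add_right_mono[OF abs_triangle_ineq]])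
      also have "\<dots> \<le> e / 4 * h\<^sup>2 + 2 * (e / 4 * h\<^sup>2) + e / 4 * h\<^sup>2"
      proof (intro add_mono B1 BR)
        show "\<bar>\<gamma> * (H (d h) (d h) - h\<^sup>2 * H v v)\<bar> \<le> 2 * (e / 4 * h\<^sup>2)"
          unfolding abs_mult using g B2 by (intro mult_mono) auto
      qed
      also have "\<dots> = e * h\<^sup>2" by simp
      finally show "\<bar>G' (x + \<gamma> *\<^sub>R d h) (d h) - h\<^sup>2 * ((1/2 - \<gamma>) * G' x w)\<bar> \<le> e * h\<^sup>2" .
    qed
  qed
qed

text \<open>
  A quantitative scalar inverse function theorem. Since \<open>\<phi>\<close> gains at least \<open>m\<close> per unit length, it makes up
  for the value \<open>\<phi> a\<close> within distance \<open>\<bar>\<phi> a\<bar> / m\<close>, and it cannot vanish twice.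
\<close>

lemma unique_zero_near_point:
  fixes \<phi> \<phi>' :: "real \<Rightarrow> real"
  assumes der: "\<And>s. s \<in> {a - \<delta>..a + \<delta>} \<Longrightarrow> (\<phi> has_real_derivative \<phi>' s) (at s)"
    and low: "\<And>s. s \<in> {a - \<delta>..a + \<delta>} \<Longrightarrow> m \<le> \<phi>' s"
    and "m > 0" "\<delta> \<ge> 0" and small: "\<bar>\<phi> a\<bar> \<le> m * \<delta>"
  shows "\<exists>s\<in>{a - \<delta>..a + \<delta>}. \<phi> s = 0 \<and> \<bar>s - a\<bar> \<le> \<bar>\<phi> a\<bar> / m \<and>
    (\<forall>t\<in>{a - \<delta>..a + \<delta>}. \<phi> t = 0 \<longrightarrow> t = s)"
proof -
  have growth: "m * (t - s) \<le> \<phi> t - \<phi> s" if st: "a - \<delta> \<le> s" "s \<le> t" "t \<le> a + \<delta>" for s t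
  proof -
    have "\<phi> s - m * s \<le> \<phi> t - m * t"
    proof (rule DERIV_nonneg_imp_nondecreasing[OF st(2)])
      fix r assume "s \<le> r" "r \<le> t"
      then have r: "r \<in> {a - \<delta>..a + \<delta>}" using st by auto
      show "\<exists>y. ((\<lambda>s. \<phi> s - m * s) has_real_derivative y) (at r) \<and> 0 \<le> y"
        using DERIV_diff[OF der[OF r] DERIV_cmult_Id[of m]] low[OF r] by auto
    qed
    then show ?thesis by (simp add: algebra_simps)
  qed
  have "continuous_on {a - \<delta>..a + \<delta>} \<phi>"
    using der by (intro continuous_at_imp_continuous_on ballI DERIV_isCont)
  moreover have "\<phi> (a - \<delta>) \<le> 0" "0 \<le> \<phi> (a + \<delta>)"
    using growth[of "a - \<delta>" a] growth[of a "a + \<delta>"] small \<open>\<delta> \<ge> 0\<close> by auto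
  ultimately obtain s where s: "a - \<delta> \<le> s" "s \<le> a + \<delta>" "\<phi> s = 0"
    using IVT'[of \<phi> "a - \<delta>" 0 "a + \<delta>"] \<open>\<delta> \<ge> 0\<close> by auto
  have close: "m * \<bar>s - a\<bar> \<le> \<bar>\<phi> a\<bar>"
  proof (cases "s \<le> a")
    case True
    then show ?thesis using growth[of s a] s \<open>\<delta> \<ge> 0\<close> by (simp add: abs_of_nonpos)
  next
    case False
    then show ?thesis using growth[of a s] s \<open>\<delta> \<ge> 0\<close> by simp
  qed
  have unique: "t = s" if "t \<in> {a - \<delta>..a + \<delta>}" "\<phi> t = 0" for t
  proof -
    have "\<not> s < t" using growth[of s t] s that mult_pos_pos[OF \<open>m > 0\<close>, of "t - s"] by auto
    moreover have "\<not> t < s" using growth[of t s] s that mult_pos_pos[OF \<open>m > 0\<close>, of "s - t"] by auto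
    ultimately show ?thesis by simp
  qed
  show ?thesis
  proof (intro bexI[of _ s] conjI ballI impI)
    show "\<bar>s - a\<bar> \<le> \<bar>\<phi> a\<bar> / m"
      using close \<open>m > 0\<close> by (simp add: pos_le_divide_eq mult.commute)
    show "s \<in> {a - \<delta>..a + \<delta>}" using s by simp
  qed (use s unique in blast)+
qed

text \<open>
  The heart of the matter. As a function of \<open>\<gamma>\<close>, the defect \<open>G (x + \<gamma> d) - G x\<close> is \<open>O(h ^ (p + 1))\<close> at
  \<open>\<gamma> = 1\<close>, while its slope near \<open>\<gamma> = 1\<close> is bounded away from zero by a multiple of \<open>h\<^sup>2\<close>. The zero is
  therefore at distance \<open>O(h ^ (p + 1) / h\<^sup>2)\<close> from \<open>1\<close>. The condition \<open>p \<ge> 2\<close> makes this distance tend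
  to \<open>0\<close>, so that the zero lies in the fixed interval \<open>{3/4..5/4}\<close>. This interval stays away from
  \<open>\<gamma> = 1/2\<close>, where the slope changes sign, and from the trivial zero \<open>\<gamma> = 0\<close>.
\<close>

lemma unique_level_point_on_chord:
  fixes G :: "'a::real_normed_vector \<Rightarrow> real" and G' :: "'a \<Rightarrow> 'a \<Rightarrow>\<^sub>L real"
    and H :: "'a \<Rightarrow>\<^sub>L 'a \<Rightarrow>\<^sub>L real"
  assumes "open D" "x \<in> D"
    and G: "\<And>y. y \<in> D \<Longrightarrow> (G has_derivative blinfun_apply (G' y)) (at y)"
    and H: "(G' has_derivative blinfun_apply H) (at x)"
    and d: "((\<lambda>h. (d h - h *\<^sub>R v) /\<^sub>R h\<^sup>2) \<longlongrightarrow> w /\<^sub>R 2) (at_right 0)"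
    and first: "G' x v = 0" and second: "G' x w + H v v = 0"
    and nz: "G' x w \<noteq> 0" and "p \<ge> 2"
    and defect: "(\<lambda>h. G (x + d h) - G x) \<in> O[at_right 0](\<lambda>h. h ^ (p + 1))"
  obtains \<gamma> where
    "\<forall>\<^sub>F h in at_right 0. \<gamma> h \<in> {3/4..5/4} \<and> G (x + \<gamma> h *\<^sub>R d h) = G x \<and>
       (\<forall>s\<in>{3/4..5/4}. G (x + s *\<^sub>R d h) = G x \<longrightarrow> s = \<gamma> h)"
    "(\<lambda>h. \<gamma> h - 1) \<in> O[at_right 0](\<lambda>h. h ^ (p - 1))"
proof -
  define c where "c = G' x w"
  \<comment> \<open>On \<open>{3/4..5/4}\<close> the leading part of the slope is at least \<open>\<bar>c\<bar> h\<^sup>2 / 4\<close>; half of it absorbs the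
    error term.\<close>
  define m where "m h = \<bar>c\<bar> / 8 * h\<^sup>2" for h
  have c: "\<bar>c\<bar> > 0" using nz by (simp add: c_def)
  have p: "h ^ (p + 1) = h\<^sup>2 * h ^ (p - 1)" for h :: real
    using \<open>p \<ge> 2\<close> by (simp flip: power_add)
  obtain r where r: "r > 0" "ball x r \<subseteq> D" using assms(1,2) open_contains_ball by blast
  obtain C where C: "C > 0" "\<forall>\<^sub>F h in at_right 0. norm (G (x + d h) - G x) \<le> C * norm (h ^ (p + 1))"
    using defect by (rule landau_o.bigE)
  have small: "\<forall>\<^sub>F h in at_right 0. norm (d h) < r / 2"
    using tendstoD[OF chord_quotient_tendsto(2)[OF d], of "r/2"] r(1) by simp
  have "((\<lambda>h::real. h ^ (p - 1)) \<longlongrightarrow> 0 ^ (p - 1)) (at_right 0)" by (intro tendsto_intros)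
  \<comment> \<open>This makes the defect at \<open>1\<close> at most \<open>m h / 4\<close>, as needed for a zero within distance \<open>1/4\<close>.\<close>
  then have pow: "\<forall>\<^sub>F h in at_right 0. h ^ (p - 1) < \<bar>c\<bar> / (32 * C)"
    by (rule order_tendstoD) (use \<open>p \<ge> 2\<close> c C(1) in \<open>auto simp: power_0_left\<close>)
  define P where "P h s \<longleftrightarrow> s \<in> {3/4..5/4} \<and> G (x + s *\<^sub>R d h) = G x \<and>
      (\<forall>t\<in>{3/4..5/4}. G (x + t *\<^sub>R d h) = G x \<longrightarrow> t = s) \<and> \<bar>s - 1\<bar> \<le> (8 * C / \<bar>c\<bar>) * h ^ (p - 1)" for h s
  have c8: "\<bar>c\<bar> / 8 > 0" using c by simp
  have ex: "\<forall>\<^sub>F h in at_right 0. \<exists>s. P h s"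
    using derivative_along_chord_asymptotics[OF H d first second c8]
      C(2) small pow eventually_at_right_less[of "0::real"]
  proof eventually_elim
    case (elim h)
    have h: "h > 0" using elim by simp
    have asym: "\<bar>G' (x + s *\<^sub>R d h) (d h) - h\<^sup>2 * ((1/2 - s) * c)\<bar> \<le> m h" if "\<bar>s\<bar> \<le> 2" for s
      using elim(1) c that by (simp add: c_def m_def)
    have mh: "m h > 0" using c h by (simp add: m_def)
    \<comment> \<open>The factor \<open>- sgn c\<close> makes the slope positive near \<open>1\<close>, where \<open>1/2 - \<gamma> < 0\<close>.\<close>
    define \<phi> where "\<phi> s = - sgn c * (G (x + s *\<^sub>R d h) - G x)" for s
    define \<phi>' where "\<phi>' s = - sgn c * G' (x + s *\<^sub>R d h) (d h)" for s
    have phi0: "\<phi> s = 0 \<longleftrightarrow> G (x + s *\<^sub>R d h) = G x" for s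
      using c by (simp add: \<phi>_def sgn_if)
    have \<phi>1: "\<bar>\<phi> 1\<bar> \<le> C * (h\<^sup>2 * h ^ (p - 1))"
    proof -
      have "\<bar>\<phi> 1\<bar> = norm (G (x + d h) - G x)" using c by (simp add: \<phi>_def abs_mult sgn_if)
      also have "\<dots> \<le> C * h ^ (p + 1)" using elim(2) h by simp
      finally show ?thesis unfolding p .
    qed
    have "\<exists>s\<in>{1 - 1/4..1 + 1/4}. \<phi> s = 0 \<and> \<bar>s - 1\<bar> \<le> \<bar>\<phi> 1\<bar> / m h \<and>
        (\<forall>t\<in>{1 - 1/4..1 + 1/4}. \<phi> t = 0 \<longrightarrow> t = s)"
    proof (rule unique_zero_near_point[OF _ _ mh])
      fix s :: real assume s: "s \<in> {1 - 1/4..1 + 1/4}"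
      have "\<bar>s\<bar> * norm (d h) \<le> 2 * norm (d h)" using s by (intro mult_right_mono) auto
      then have "x + s *\<^sub>R d h \<in> D"
        using elim(3) r(2) by (auto simp: dist_norm subset_eq)
      from G[OF this]
      have "((\<lambda>s. G (x + s *\<^sub>R d h)) has_derivative (\<lambda>k. G' (x + s *\<^sub>R d h) (k *\<^sub>R d h))) (at s)"
        by (rule has_derivative_compose[rotated]) (auto intro!: derivative_eq_intros)
      then have "((\<lambda>s. G (x + s *\<^sub>R d h)) has_real_derivative G' (x + s *\<^sub>R d h) (d h)) (at s)"
        by (simp add: has_field_derivative_def blinfun.scaleR_right mult.commute[of _ "blinfun_apply _ _"])
      then show "(\<phi> has_real_derivative \<phi>' s) (at s)"
        unfolding \<phi>_def \<phi>'_def by (auto intro!: derivative_eq_intros)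
      have "\<bar>c\<bar> * (s - 1/2) \<ge> \<bar>c\<bar> * (1/4)" using s c by (intro mult_left_mono) auto
      then have "h\<^sup>2 * (\<bar>c\<bar> * (s - 1/2)) \<ge> h\<^sup>2 * (\<bar>c\<bar> * (1/4))" by (rule mult_left_mono) simp
      moreover have "h\<^sup>2 * (\<bar>c\<bar> * (1/4)) = 2 * m h" by (simp add: m_def)
      ultimately have "h\<^sup>2 * (\<bar>c\<bar> * (s - 1/2)) \<ge> 2 * m h" by linarith
      moreover have "\<bar>c\<bar> * (s - 1/2) = - sgn c * ((1/2 - s) * c)"
        using c by (cases "c > 0") (auto simp: sgn_if algebra_simps)
      then have "h\<^sup>2 * (\<bar>c\<bar> * (s - 1/2)) = - sgn c * (h\<^sup>2 * ((1/2 - s) * c))" by simp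
      moreover have "\<bar>- sgn c * (G' (x + s *\<^sub>R d h) (d h) - h\<^sup>2 * ((1/2 - s) * c))\<bar> \<le> m h"
        using asym[of s] s c by (simp add: abs_mult sgn_if)
      ultimately show "m h \<le> \<phi>' s"
        unfolding \<phi>'_def right_diff_distrib by linarith
    next
      note \<phi>1
      also have "C * (h\<^sup>2 * h ^ (p - 1)) \<le> C * (h\<^sup>2 * (\<bar>c\<bar> / (32 * C)))"
        using elim(4) C(1) by (intro mult_left_mono) auto
      finally show "\<bar>\<phi> 1\<bar> \<le> m h * (1/4)" using C(1) by (simp add: m_def mult.commute)
    qed simp
    then obtain s where s: "s \<in> {1 - 1/4..1 + 1/4}" "\<phi> s = 0" "\<bar>s - 1\<bar> \<le> \<bar>\<phi> 1\<bar> / m h"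
        "\<forall>t\<in>{1 - 1/4..1 + 1/4}. \<phi> t = 0 \<longrightarrow> t = s" by blast
    have "\<bar>\<phi> 1\<bar> / m h \<le> C * (h\<^sup>2 * h ^ (p - 1)) / m h"
      using \<phi>1 mh by (intro divide_right_mono) auto
    also have "\<dots> = (8 * C / \<bar>c\<bar>) * h ^ (p - 1)" using h c by (simp add: m_def)
    finally have "\<bar>s - 1\<bar> \<le> (8 * C / \<bar>c\<bar>) * h ^ (p - 1)" using s(3) by linarith
    moreover have "{1 - 1/4..1 + 1/4} = {3/4..5/4::real}" by simp
    ultimately show ?case using s(1,2,4) unfolding P_def phi0 by (metis (no_types, lifting))
  qed
  define \<gamma> where "\<gamma> h = (SOME s. P h s)" for h
  have P\<gamma>: "\<forall>\<^sub>F h in at_right 0. P h (\<gamma> h)"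
    using ex unfolding \<gamma>_def by (rule eventually_mono) (rule someI_ex)
  show ?thesis
  proof
    show "\<forall>\<^sub>F h in at_right 0. \<gamma> h \<in> {3/4..5/4} \<and> G (x + \<gamma> h *\<^sub>R d h) = G x \<and>
       (\<forall>s\<in>{3/4..5/4}. G (x + s *\<^sub>R d h) = G x \<longrightarrow> s = \<gamma> h)"
      using P\<gamma> unfolding P_def by (rule eventually_mono) blast
    show "(\<lambda>h. \<gamma> h - 1) \<in> O[at_right 0](\<lambda>h. h ^ (p - 1))"
    proof (rule bigoI)
      show "\<forall>\<^sub>F h in at_right 0. norm (\<gamma> h - 1) \<le> (8 * C / \<bar>c\<bar>) * norm (h ^ (p - 1))"
        using P\<gamma> eventually_at_right_less[of "0::real"]
      proof eventually_elim
        case (elim h)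
        then have "\<bar>\<gamma> h - 1\<bar> \<le> (8 * C / \<bar>c\<bar>) * h ^ (p - 1)" unfolding P_def by blast
        then show ?case using elim(2) by simp
      qed
    qed
  qed
qed

section \<open>Consistency at the relaxed time\<close>

text \<open>
  Both the chord point \<open>u a + \<gamma> d\<close> and the curve point \<open>u (a + \<gamma> h)\<close> move by \<open>(\<gamma> - 1) h (v a + O(h))\<close> when the
  parameter changes from \<open>1\<close> to \<open>\<gamma>\<close>. The leading terms cancel, so only \<open>(\<gamma> - 1) O(h\<^sup>2) = O(h ^ (p + 1))\<close>
  is added to the error at parameter \<open>1\<close>. Measuring the error at the unrelaxed time \<open>a + h\<close> would leave \<open>(\<gamma> - 1) h v a\<close> and lose one
  order.
\<close>

lemma chord_follows_curve:
  fixes u v :: "real \<Rightarrow> 'a::real_normed_vector"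
  assumes du: "\<And>t. t \<in> {a..a + T} \<Longrightarrow> (u has_vector_derivative v t) (at t within {a..a + T})"
    and dv: "(v has_vector_derivative w) (at a within {a..a + T})" and "T > 0" and "p \<ge> 1"
    and d: "(\<lambda>h. norm (u a + d h - u (a + h))) \<in> O[at_right 0](\<lambda>h. h ^ (p + 1))"
    and \<gamma>: "(\<lambda>h. \<gamma> h - 1) \<in> O[at_right 0](\<lambda>h. h ^ (p - 1))"
    and \<gamma>02: "\<forall>\<^sub>F h in at_right 0. \<gamma> h \<in> {0..2}"
  shows "(\<lambda>h. norm (u a + \<gamma> h *\<^sub>R d h - u (a + \<gamma> h * h))) \<in> O[at_right 0](\<lambda>h. h ^ (p + 1))"
proof -
  define k where "k = norm w + 1"
  have k: "k > 0" by (simp add: k_def add_nonneg_pos)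
  obtain C where C: "C > 0" "\<forall>\<^sub>F h in at_right 0. norm (norm (u a + d h - u (a + h))) \<le> C * norm (h ^ (p + 1))"
    using d by (rule landau_o.bigE)
  obtain B where B: "B > 0" "\<forall>\<^sub>F h in at_right 0. norm (\<gamma> h - 1) \<le> B * norm (h ^ (p - 1))"
    using \<gamma> by (rule landau_o.bigE)
  have "\<forall>\<^sub>F h in at_right 0. norm ((v (a + h) - v a) /\<^sub>R h) < k"
    by (rule order_tendstoD[OF tendsto_norm[OF right_difference_quotient[OF dv \<open>T > 0\<close>]]])
       (simp add: k_def)
  then obtain b where b: "b > 0" "\<And>h. 0 < h \<Longrightarrow> h < b \<Longrightarrow> norm ((v (a + h) - v a) /\<^sub>R h) < k"
    unfolding eventually_at_right_field by auto
  have Lip: "norm (v t - v a) \<le> k * (t - a)" if "t \<in> {a..<a + b}" for t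
  proof (cases "t = a")
    case False
    then have "t - a > 0" using that by simp
    then show ?thesis
      using b(2)[of "t - a"] that by (simp add: inverse_eq_divide pos_divide_less_eq)
  qed simp
  have "\<forall>\<^sub>F h in at_right 0. h < min (b/2) (T/2)"
    by (rule order_tendstoD[OF tendsto_ident_at]) (use b(1) \<open>T > 0\<close> in simp)
  with C(2) B(2) \<gamma>02 eventually_at_right_less[of "0::real"]
  have "\<forall>\<^sub>F h in at_right 0. norm (norm (u a + \<gamma> h *\<^sub>R d h - u (a + \<gamma> h * h)))
      \<le> (2 * C + 4 * k * B) * norm (h ^ (p + 1))"
  proof eventually_elim
    case (elim h)
    let ?S = "{a..a + 2 * h}"
    let ?\<gamma> = "\<gamma> h"
    have h: "h > 0" "2 * h < b" "2 * h < T" using elim by auto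
    have g: "0 \<le> ?\<gamma>" "?\<gamma> \<le> 2" using elim by auto
    have incr: "norm (u t - u s - (t - s) *\<^sub>R v a) \<le> norm (t - s) * (k * (2 * h))"
      if "s \<in> ?S" "t \<in> ?S" for s t
    proof (rule vector_differentiable_bound_linearization)
      fix r assume r: "r \<in> ?S"
      show "(u has_vector_derivative v r) (at r within ?S)"
        using r h by (intro has_vector_derivative_within_subset[OF du]) auto
      have "norm (v r - v a) \<le> k * (r - a)" using r h by (intro Lip) auto
      also have "\<dots> \<le> k * (2 * h)" using r k by (intro mult_left_mono) auto
      finally show "norm (v r - v a) \<le> k * (2 * h)" .
    next
      show "closed_segment s t \<subseteq> ?S" using that by (auto simp: closed_segment_eq_real_ivl)
    qed (use h in auto)
    have gh: "a + ?\<gamma> * h \<in> ?S" using g h by auto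
    have I1: "norm (u (a + h) - u a - h *\<^sub>R v a) \<le> 2 * k * h\<^sup>2"
      using incr[of a "a + h"] h by (simp add: power2_eq_square mult_ac)
    have I2: "norm (u (a + ?\<gamma> * h) - u (a + h) - ((?\<gamma> - 1) * h) *\<^sub>R v a) \<le> \<bar>?\<gamma> - 1\<bar> * (2 * k * h\<^sup>2)"
    proof -
      have shift: "a + ?\<gamma> * h - (a + h) = (?\<gamma> - 1) * h" by (simp add: algebra_simps)
      have "a + h \<in> ?S" using h by auto
      from incr[OF this gh]
      have "norm (u (a + ?\<gamma> * h) - u (a + h) - ((?\<gamma> - 1) * h) *\<^sub>R v a)
          \<le> norm ((?\<gamma> - 1) * h) * (k * (2 * h))"
        unfolding shift .
      also have "\<dots> = \<bar>?\<gamma> - 1\<bar> * (2 * k * h\<^sup>2)"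
        using h by (simp add: abs_mult power2_eq_square)
      finally show ?thesis .
    qed
    \<comment> \<open>The common displacement \<open>(\<gamma> - 1) h v a\<close> is added and subtracted.\<close>
    have split: "u a + ?\<gamma> *\<^sub>R d h - u (a + ?\<gamma> * h) =
        ?\<gamma> *\<^sub>R (u a + d h - u (a + h)) + (?\<gamma> - 1) *\<^sub>R (u (a + h) - u a - h *\<^sub>R v a)
        - (u (a + ?\<gamma> * h) - u (a + h) - ((?\<gamma> - 1) * h) *\<^sub>R v a)"
      by (simp add: algebra_simps)
    have J1: "norm (?\<gamma> *\<^sub>R (u a + d h - u (a + h))) \<le> 2 * (C * h ^ (p + 1))"
      unfolding norm_scaleR using g elim(1) h by (intro mult_mono) auto
    have J2: "norm ((?\<gamma> - 1) *\<^sub>R (u (a + h) - u a - h *\<^sub>R v a)) \<le> \<bar>?\<gamma> - 1\<bar> * (2 * k * h\<^sup>2)"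
      unfolding norm_scaleR using I1 by (intro mult_left_mono) auto
    have "\<bar>?\<gamma> - 1\<bar> * (2 * k * h\<^sup>2) \<le> (B * h ^ (p - 1)) * (2 * k * h\<^sup>2)"
      using elim(2) h k by (intro mult_right_mono) auto
    also have "\<dots> = 2 * k * B * (h\<^sup>2 * h ^ (p - 1))" by simp
    also have "h\<^sup>2 * h ^ (p - 1) = h ^ (p + 1)"
      using \<open>p \<ge> 1\<close> by (simp flip: power_add)
    finally have J3: "\<bar>?\<gamma> - 1\<bar> * (2 * k * h\<^sup>2) \<le> 2 * k * B * h ^ (p + 1)" .
    have "norm (u a + ?\<gamma> *\<^sub>R d h - u (a + ?\<gamma> * h)) \<le>
        norm (?\<gamma> *\<^sub>R (u a + d h - u (a + h))) + norm ((?\<gamma> - 1) *\<^sub>R (u (a + h) - u a - h *\<^sub>R v a))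
        + norm (u (a + ?\<gamma> * h) - u (a + h) - ((?\<gamma> - 1) * h) *\<^sub>R v a)"
      unfolding split by (rule order_trans[OF norm_triangle_ineq4 add_right_mono[OF norm_triangle_ineq]])
    also have "\<dots> \<le> 2 * (C * h ^ (p + 1)) + 2 * (2 * k * B * h ^ (p + 1))"
      using J1 J2 J3 I2 by linarith
    also have "\<dots> = (2 * C + 4 * k * B) * h ^ (p + 1)" by (simp add: algebra_simps)
    finally show ?case using h by simp
  qed
  then show ?thesis by (rule bigoI)
qed

section \<open>The relaxation method\<close>

text \<open>
  Second-order smoothness of \<open>\<eta> \<circ> \<pi>\<close> in the form needed for the chord: the derivative exists on the
  domain and is itself differentiable at one point.
\<close>

lemma derivatives_of_composition:
  fixes \<eta> :: "'a::real_normed_vector \<Rightarrow> 'b::real_normed_vector"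
    and \<pi> :: "'c::real_normed_vector \<Rightarrow> 'a"
  assumes eta: "\<And>v. v \<in> D \<Longrightarrow> (\<eta> has_derivative blinfun_apply (\<eta>' v)) (at v)"
    and "(\<eta>' has_derivative \<eta>'') (at (\<pi> x))"
    and pi: "\<And>v. v \<in> E \<Longrightarrow> (\<pi> has_derivative blinfun_apply (\<pi>' v)) (at v)"
    and "(\<pi>' has_derivative \<pi>'') (at x)"
    and "\<pi> ` E \<subseteq> D" "x \<in> E"
  obtains H where
    "\<And>v. v \<in> E \<Longrightarrow> ((\<lambda>v. \<eta> (\<pi> v)) has_derivative blinfun_apply (\<eta>' (\<pi> v) o\<^sub>L \<pi>' v)) (at v)"
    "((\<lambda>v. \<eta>' (\<pi> v) o\<^sub>L \<pi>' v) has_derivative blinfun_apply H) (at x)"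
proof -
  have 1: "((\<lambda>v. \<eta> (\<pi> v)) has_derivative blinfun_apply (\<eta>' (\<pi> v) o\<^sub>L \<pi>' v)) (at v)" if "v \<in> E" for v
    using has_derivative_compose[OF pi[OF that] eta[of "\<pi> v"]] that assms(5)
    by (auto simp: blinfun_compose.rep_eq o_def)
  obtain F where F: "((\<lambda>v. \<eta>' (\<pi> v) o\<^sub>L \<pi>' v) has_derivative F) (at x)"
    using bounded_bilinear.FDERIV[OF bounded_bilinear_blinfun_compose
        has_derivative_compose[OF pi[OF \<open>x \<in> E\<close>] assms(2)] assms(4)] by blast
  then have "blinfun_apply (Blinfun F) = F"
    by (intro bounded_linear_Blinfun_apply has_derivative_bounded_linear)
  with F show ?thesis
    using that[OF 1, of "Blinfun F"] by simp
qed

theorem theorem3p1: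
  fixes f :: "'a::euclidean_space \<Rightarrow> 'a"
    and \<eta> \<mu> :: "'a \<Rightarrow> real"
    and \<pi> :: "'a \<Rightarrow> 'a"
    and \<Phi> :: "real \<Rightarrow> 'a \<Rightarrow> 'a"
    and u :: "real \<Rightarrow> 'a"
    and D :: "'a set"
    and un :: 'a
    and tn T :: real
    and p :: nat
  assumes "open D" and "un \<in> D"
    and "C1_on D f" and "C2_on D \<eta>" and "C2_on D \<pi>"
    and "ode_invariant_on D f \<eta>" and "ode_invariant_on D f \<mu>"
    and "projection_onto D (level_set_through D \<mu> un) \<pi>"
    and "T > 0" and "ode_solution_on D f u {tn..tn + T}" and "u tn = un"
    and "p \<ge> 2" and "local_error_order u (\<lambda>h. tn + h) (\<lambda>h. \<Phi> h un) p"
    and "frechet_derivative \<eta> (at un)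
           (frechet_derivative \<pi> (at un) (frechet_derivative f (at un) (f un))) \<noteq> 0"
  shows "\<exists>\<gamma> :: real \<Rightarrow> real.
      relaxation_parameter D \<eta> \<pi> \<Phi> un p \<gamma> \<and>
      (\<forall>\<gamma>'. relaxation_parameter D \<eta> \<pi> \<Phi> un p \<gamma>' \<longrightarrow> (\<forall>\<^sub>F h in at_right 0. \<gamma>' h = \<gamma> h)) \<and>
      local_error_order u (\<lambda>h. tn + \<gamma> h * h) (\<lambda>h. relaxed_step \<pi> \<Phi> un h (\<gamma> h)) p \<and>
      (\<forall>\<^sub>F h in at_right 0.
         \<eta> (relaxed_step \<pi> \<Phi> un h (\<gamma> h)) = \<eta> un \<and>
         \<mu> (relaxed_step \<pi> \<Phi> un h (\<gamma> h)) = \<mu> un)"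
proof -
  note D = \<open>open D\<close> \<open>un \<in> D\<close>
  obtain \<eta>' \<eta>'' where eta: "\<And>v. v \<in> D \<Longrightarrow> (\<eta> has_derivative blinfun_apply (\<eta>' v)) (at v)"
      "\<And>v. v \<in> D \<Longrightarrow> (\<eta>' has_derivative blinfun_apply (\<eta>'' v)) (at v)"
    using \<open>C2_on D \<eta>\<close> unfolding C2_on_def C1_on_def by metis
  obtain \<pi>' \<pi>'' where pi: "\<And>v. v \<in> D \<Longrightarrow> (\<pi> has_derivative blinfun_apply (\<pi>' v)) (at v)"
      "\<And>v. v \<in> D \<Longrightarrow> (\<pi>' has_derivative blinfun_apply (\<pi>'' v)) (at v)"
    using \<open>C2_on D \<pi>\<close> unfolding C2_on_def C1_on_def by metis
  obtain f' where f': "(f has_derivative blinfun_apply f') (at un)"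
    using \<open>C1_on D f\<close> D(2) unfolding C1_on_def by metis
  have piM: "\<pi> v \<in> D" "\<mu> (\<pi> v) = \<mu> un" if "v \<in> D" for v
    using assms(8) that by (auto simp: projection_onto_def level_set_through_def)
  have pi_fix: "\<pi> v = v" if "v \<in> D" "\<mu> v = \<mu> un" for v
    using assms(8) that by (auto simp: projection_onto_def level_set_through_def)
  have pi_un: "\<pi> un = un" using pi_fix D(2) by simp

  define I where "I = {tn..tn + T}"
  have uD: "u t \<in> D" and du: "(u has_vector_derivative f (u t)) (at t within I)" if "t \<in> I" for t
    using assms(10) that by (auto simp: ode_solution_on_def I_def)
  have tn: "tn \<in> I" using \<open>T > 0\<close> by (simp add: I_def)
  have dv: "((\<lambda>t. f (u t)) has_vector_derivative f' (f un)) (at tn within I)"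
    using has_derivative_compose[OF du[OF tn, unfolded has_vector_derivative_def], of f f'] f'
    by (simp add: has_vector_derivative_def blinfun.scaleR_right \<open>u tn = un\<close>)
  \<comment> \<open>Exact solutions stay in the level set of \<open>\<mu>\<close>, where \<open>\<pi>\<close> is the identity.\<close>
  have pi_u: "\<pi> (u t) = u t" if "t \<in> I" for t
    using invariant_constant_along_solution[OF assms(7,10)] that
    by (intro pi_fix uD) (auto simp: I_def \<open>u tn = un\<close>)
  have eta_u: "\<eta> (u t) = \<eta> un" if "t \<in> I" for t
    using invariant_constant_along_solution[OF assms(6,10)] that by (auto simp: I_def \<open>u tn = un\<close>)

  define G where "G = (\<lambda>v. \<eta> (\<pi> v))"
  define G' where "G' = (\<lambda>v. \<eta>' (\<pi> v) o\<^sub>L \<pi>' v)"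
  have eta_un: "(\<eta>' has_derivative blinfun_apply (\<eta>'' un)) (at (\<pi> un))" and "\<pi> ` D \<subseteq> D"
    using eta(2)[OF D(2)] piM(1) by (auto simp: pi_un)
  obtain H where G: "\<And>v. v \<in> D \<Longrightarrow> (G has_derivative blinfun_apply (G' v)) (at v)"
      "(G' has_derivative blinfun_apply H) (at un)"
    using derivatives_of_composition[OF eta(1) eta_un pi(1) pi(2)[OF D(2)] \<open>\<pi> ` D \<subseteq> D\<close> D(2)]
    unfolding G_def G'_def by blast
  have nz: "G' un (f' (f un)) \<noteq> 0"
    using assms(14) frechet_derivative_at[OF eta(1)[OF D(2)]] frechet_derivative_at[OF pi(1)[OF D(2)]]
      frechet_derivative_at[OF f']
    by (simp add: G'_def pi_un blinfun_compose.rep_eq)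
  have G_u: "G (u t) = \<eta> un" if "t \<in> I" for t using pi_u eta_u that by (simp add: G_def)
  have G_un: "G un = \<eta> un" by (simp add: G_def pi_un)
  have G'_un: "G' un (f un) = 0" "G' un (f' (f un)) + H (f un) (f un) = 0"
    using constant_along_curve_derivatives[of D G G' H u tn "tn + T" "\<lambda>t. f (u t)" "f' (f un)"]
      G uD du dv G_u G_un \<open>T > 0\<close> tn
    by (auto simp: I_def \<open>u tn = un\<close>)

  note Taylor = right_Taylor_2[of tn T u "\<lambda>t. f (u t)", folded I_def, OF du dv \<open>T > 0\<close>,
      unfolded \<open>u tn = un\<close>]
  have u_tendsto: "((\<lambda>h. u (tn + h)) \<longlongrightarrow> un) (at_right 0)"
    using chord_quotient_tendsto(2)[OF Taylor] by (simp add: LIM_zero_iff)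
  have hT: "\<forall>\<^sub>F h in at_right 0. h \<in> {0<..<T / 2}"
    using eventually_at_right_less[of "0::real"]
      order_tendstoD(2)[OF tendsto_ident_at, of 0 "T / 2" "{0<..}"] \<open>T > 0\<close>
    by (auto elim: eventually_elim2)

  have \<Phi>_err: "(\<lambda>h. norm (\<Phi> h un - u (tn + h))) \<in> O[at_right 0](\<lambda>h. h ^ (p + 1))"
    using assms(13) by (simp add: local_error_order_def)
  have "((\<lambda>h. (\<Phi> h un - u (tn + h)) + u (tn + h)) \<longlongrightarrow> 0 + un) (at_right 0)"
    using bigo_power_quotient_tendsto_0[where k = 0 and n = "p + 1"] \<Phi>_err
    by (intro tendsto_add u_tendsto) simp
  then have \<Phi>_tendsto: "((\<lambda>h. \<Phi> h un) \<longlongrightarrow> un) (at_right 0)" by simp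
  have \<Phi>D: "\<forall>\<^sub>F h in at_right 0. \<Phi> h un \<in> D"
    using topological_tendstoD[OF \<Phi>_tendsto D] .

  define d where "d h = \<pi> (\<Phi> h un) - un" for h
  have cont_pi: "isCont \<pi>' un" and cont_G: "isCont G' un"
    using pi(2)[OF D(2)] G(2) by (auto intro: has_derivative_continuous)
  \<comment> \<open>Projecting the provisional value keeps its order because \<open>\<pi>\<close> fixes \<open>u (tn + h)\<close>.\<close>
  have "(\<lambda>h. norm (\<pi> (\<Phi> h un) - \<pi> (u (tn + h)))) \<in> O[at_right 0](\<lambda>h. h ^ (p + 1))"
    by (rule bigo_Lipschitz_image[OF D pi(1) cont_pi \<Phi>_tendsto u_tendsto \<Phi>_err])
  moreover have "\<forall>\<^sub>F h in at_right 0. norm (\<pi> (\<Phi> h un) - \<pi> (u (tn + h))) = norm (un + d h - u (tn + h))"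
    using hT by eventually_elim (simp add: pi_u I_def d_def)
  ultimately have d_err: "(\<lambda>h. norm (un + d h - u (tn + h))) \<in> O[at_right 0](\<lambda>h. h ^ (p + 1))"
    by (simp add: landau_o.big.in_cong)
  \<comment> \<open>Since \<open>p + 1 > 2\<close>, the increment \<open>d\<close> inherits the second-order expansion of \<open>u\<close>.\<close>
  have "((\<lambda>h. (un + d h - u (tn + h)) /\<^sub>R h\<^sup>2 + (u (tn + h) - un - h *\<^sub>R f un) /\<^sub>R h\<^sup>2)
      \<longlongrightarrow> 0 + f' (f un) /\<^sub>R 2) (at_right 0)"
    using bigo_power_quotient_tendsto_0[where k = 2 and n = "p - 1"] d_err \<open>p \<ge> 2\<close>
    by (intro tendsto_add Taylor) (simp add: eval_nat_numeral)
  then have d_lim: "((\<lambda>h. (d h - h *\<^sub>R f un) /\<^sub>R h\<^sup>2) \<longlongrightarrow> f' (f un) /\<^sub>R 2) (at_right 0)"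
    by (simp flip: scaleR_add_right)

  \<comment> \<open>By idempotence of \<open>\<pi>\<close>, the value of \<open>G\<close> at the projected point \<open>un + d h\<close> equals \<open>G (\<Phi> h un)\<close>, and \<open>G\<close> is
    constant along \<open>u\<close>; so the defect at \<open>\<gamma> = 1\<close> is a baseline error.\<close>
  have "(\<lambda>h. norm (G (\<Phi> h un) - G (u (tn + h)))) \<in> O[at_right 0](\<lambda>h. h ^ (p + 1))"
    by (rule bigo_Lipschitz_image[OF D G(1) cont_G \<Phi>_tendsto u_tendsto \<Phi>_err])
  then have "(\<lambda>h. G (\<Phi> h un) - G (u (tn + h))) \<in> O[at_right 0](\<lambda>h. h ^ (p + 1))" by simp
  moreover have "\<forall>\<^sub>F h in at_right 0. G (\<Phi> h un) - G (u (tn + h)) = G (un + d h) - G un"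
    using hT \<Phi>D
    by eventually_elim (simp add: G_u G_un I_def d_def, simp add: G_def pi_fix piM)
  ultimately have defect: "(\<lambda>h. G (un + d h) - G un) \<in> O[at_right 0](\<lambda>h. h ^ (p + 1))"
    by (simp add: landau_o.big.in_cong)

  obtain \<gamma> where \<gamma>: "\<forall>\<^sub>F h in at_right 0. \<gamma> h \<in> {3/4..5/4} \<and> G (un + \<gamma> h *\<^sub>R d h) = G un \<and>
       (\<forall>s\<in>{3/4..5/4}. G (un + s *\<^sub>R d h) = G un \<longrightarrow> s = \<gamma> h)"
    and \<gamma>_O: "(\<lambda>h. \<gamma> h - 1) \<in> O[at_right 0](\<lambda>h. h ^ (p - 1))"
    by (rule unique_level_point_on_chord[OF D G d_lim G'_un nz \<open>p \<ge> 2\<close> defect])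

  have \<gamma>_near: "\<forall>\<^sub>F h in at_right 0. \<gamma> h \<in> {3/4..5/4}"
    and \<gamma>_level: "\<forall>\<^sub>F h in at_right 0. G (un + \<gamma> h *\<^sub>R d h) = G un"
    using \<gamma> by (rule eventually_mono, blast)+
  have "((\<lambda>h. \<gamma> h *\<^sub>R d h) \<longlongrightarrow> 0) (at_right 0)"
  proof (rule Lim_null_comparison)
    show "\<forall>\<^sub>F h in at_right 0. norm (\<gamma> h *\<^sub>R d h) \<le> 2 * norm (d h)"
      using \<gamma>_near by eventually_elim (auto intro!: mult_right_mono)
    show "((\<lambda>h. 2 * norm (d h)) \<longlongrightarrow> 0) (at_right 0)"
      using tendsto_mult_right_zero[OF tendsto_norm_zero[OF chord_quotient_tendsto(2)[OF d_lim]]] .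
  qed
  from tendsto_add[OF tendsto_const this, of un]
  have pre_tendsto: "((\<lambda>h. un + \<gamma> h *\<^sub>R d h) \<longlongrightarrow> un) (at_right 0)" by simp
  have preD: "\<forall>\<^sub>F h in at_right 0. un + \<gamma> h *\<^sub>R d h \<in> D"
    using topological_tendstoD[OF pre_tendsto D] .
  have pre: "relaxed_preimage \<pi> \<Phi> un h s = un + s *\<^sub>R d h"
    and step: "relaxed_step \<pi> \<Phi> un h s = \<pi> (un + s *\<^sub>R d h)" for h s
    by (simp_all add: relaxed_step_def relaxed_preimage_def d_def)

  have solves: "\<forall>\<^sub>F h in at_right 0. solves_relaxation_equation D \<eta> \<pi> \<Phi> un h (\<gamma> h)"
    using \<gamma>_level preD \<Phi>D
    by eventually_elim (simp add: solves_relaxation_equation_def pre step G_def pi_un)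
  have unique: "\<forall>\<^sub>F h in at_right 0. \<gamma>' h = \<gamma> h" if "relaxation_parameter D \<eta> \<pi> \<Phi> un p \<gamma>'" for \<gamma>'
  proof -
    \<comment> \<open>As \<open>p - 1 > 0\<close>, any competitor tends to \<open>1\<close> and hence enters the interval of uniqueness.\<close>
    have "(\<lambda>h. norm (\<gamma>' h - 1)) \<in> O[at_right 0](\<lambda>h. h ^ ((p - 1) + 0))"
      using that by (simp add: relaxation_parameter_def)
    from bigo_power_quotient_tendsto_0[OF this] have "(\<gamma>' \<longlongrightarrow> 1) (at_right 0)"
      using \<open>p \<ge> 2\<close> by (simp add: LIM_zero_iff)
    then have "\<forall>\<^sub>F h in at_right 0. 3/4 < \<gamma>' h" "\<forall>\<^sub>F h in at_right 0. \<gamma>' h < 5/4"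
      by (rule order_tendstoD; simp)+
    then have "\<forall>\<^sub>F h in at_right 0. \<gamma>' h \<in> {3/4..5/4}"
      by eventually_elim simp
    moreover have "\<forall>\<^sub>F h in at_right 0. G (un + \<gamma>' h *\<^sub>R d h) = G un"
      using that unfolding relaxation_parameter_def
      by (auto elim!: eventually_mono simp: solves_relaxation_equation_def step G_un G_def pi_un)
    ultimately show ?thesis using \<gamma> by eventually_elim blast
  qed

  have pre_err: "(\<lambda>h. norm (un + \<gamma> h *\<^sub>R d h - u (tn + \<gamma> h * h))) \<in> O[at_right 0](\<lambda>h. h ^ (p + 1))"
  proof -
    have "\<forall>\<^sub>F h in at_right 0. \<gamma> h \<in> {0..2}" using \<gamma>_near by eventually_elim auto
    then show ?thesis
      using chord_follows_curve[of tn T u "\<lambda>t. f (u t)", folded I_def,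
          OF du dv \<open>T > 0\<close> _ _ \<gamma>_O, of d] d_err \<open>p \<ge> 2\<close>
      by (simp add: \<open>u tn = un\<close>)
  qed
  have "((\<lambda>h. (un + \<gamma> h *\<^sub>R d h) - (un + \<gamma> h *\<^sub>R d h - u (tn + \<gamma> h * h))) \<longlongrightarrow> un - 0) (at_right 0)"
    using bigo_power_quotient_tendsto_0[where k = 0 and n = "p + 1"] pre_err
    by (intro tendsto_diff pre_tendsto) simp
  then have u\<gamma>_tendsto: "((\<lambda>h. u (tn + \<gamma> h * h)) \<longlongrightarrow> un) (at_right 0)" by simp
  \<comment> \<open>The last projection keeps the order for the same reason as the first one.\<close>
  have "(\<lambda>h. norm (\<pi> (un + \<gamma> h *\<^sub>R d h) - \<pi> (u (tn + \<gamma> h * h)))) \<in> O[at_right 0](\<lambda>h. h ^ (p + 1))"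
    by (rule bigo_Lipschitz_image[OF D pi(1) cont_pi pre_tendsto u\<gamma>_tendsto pre_err])
  moreover have "\<forall>\<^sub>F h in at_right 0. norm (\<pi> (un + \<gamma> h *\<^sub>R d h) - \<pi> (u (tn + \<gamma> h * h)))
      = norm (relaxed_step \<pi> \<Phi> un h (\<gamma> h) - u (tn + \<gamma> h * h))"
    using hT \<gamma>_near
  proof eventually_elim
    case (elim h)
    have "h < T / 2" using elim by simp
    moreover have "\<gamma> h * h \<le> 2 * h" "0 \<le> \<gamma> h * h" using elim by (auto intro!: mult_right_mono)
    ultimately have "0 \<le> \<gamma> h * h" "\<gamma> h * h \<le> T" by linarith+
    then have "tn + \<gamma> h * h \<in> I" by (simp add: I_def)
    then show ?case by (simp add: pi_u step)
  qed
  ultimately have order: "local_error_order u (\<lambda>h. tn + \<gamma> h * h) (\<lambda>h. relaxed_step \<pi> \<Phi> un h (\<gamma> h)) p"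
    unfolding local_error_order_def by (simp add: landau_o.big.in_cong)

  show ?thesis
  proof (intro exI[of _ \<gamma>] conjI allI impI)
    show "relaxation_parameter D \<eta> \<pi> \<Phi> un p \<gamma>"
      using solves \<gamma>_O by (simp add: relaxation_parameter_def)
    show "\<forall>\<^sub>F h in at_right 0. \<eta> (relaxed_step \<pi> \<Phi> un h (\<gamma> h)) = \<eta> un \<and>
         \<mu> (relaxed_step \<pi> \<Phi> un h (\<gamma> h)) = \<mu> un"
      using solves by eventually_elim (simp add: solves_relaxation_equation_def relaxed_step_def piM)
  qed (use unique order in auto)
qed

end
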